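(* For every integer $n \ge 1$, $R(Q_n, Q_n) \le n^2 - n + 2$.
   Context: $Q_k$ denotes the Boolean lattice of dimension $k$: the family of all subsets of a $k$-element ground set (e.g. $[k]=\{1,\dots,k\}$), ordered by inclusion. A subposet $Q'$ of a poset $Q$ is a copy of a poset $P$ if there is a bijection $f$ from $P$ to $Q'$ such that $x \le y$ in $P$ if and only if $f(x) \le f(y)$ in $Q$. For posets $P, P'$, the poset Ramsey number $R(P,P')$ is the smallest integer $N$ such that for every coloring of the elements of $Q_N$ in red and blue, there is a copy of $P$ all of whose elements are red or a copy of $P'$ all of whose elements are blue. *)

theory Defs
  imports Main "HOL-Library.Extended_Nat"
begin

(* A poset is given by its carrier, a set over a type of class order, with the induced order.
   On nat set, the order is inclusion. *)

definition boolean_lattice :: "nat \<Rightarrow> nat set set" where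
  "boolean_lattice k = Pow {1..k}"

definition is_copy :: "'a::order set \<Rightarrow> 'b::order set \<Rightarrow> bool" where
  "is_copy P Q' \<longleftrightarrow> (\<exists>f. bij_betw f P Q' \<and> (\<forall>x\<in>P. \<forall>y\<in>P. x \<le> y \<longleftrightarrow> f x \<le> f y))"

datatype colour = Red | Blue

(* Colourings are functions on the whole type; only their values on the lattice matter. *)

definition ramsey_property :: "nat \<Rightarrow> 'a::order set \<Rightarrow> 'b::order set \<Rightarrow> bool" where
  "ramsey_property N P P' \<longleftrightarrow>
     (\<forall>c :: nat set \<Rightarrow> colour.
        (\<exists>S \<subseteq> boolean_lattice N. is_copy P S \<and> (\<forall>x\<in>S. c x = Red)) \<or>
        (\<exists>S \<subseteq> boolean_lattice N. is_copy P' S \<and> (\<forall>x\<in>S. c x = Blue)))"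

(* The infimum is the minimum if some N has the property, and infinity otherwise, so a finite
   upper bound on poset_ramsey includes the existence of such an N. *)

definition poset_ramsey :: "'a::order set \<Rightarrow> 'b::order set \<Rightarrow> enat" where
  "poset_ramsey P P' = Inf {enat N | N. ramsey_property N P P'}"

end

theory Submission
  imports Defs
begin

text \<open>
  A copy of \<open>Q\<^sub>n\<close> is built in the form \<open>S \<mapsto> S \<union> g S\<close> for \<open>S \<subseteq> X\<close>, where \<open>|X| = n\<close> and \<open>g\<close> is
  monotone with values disjoint from \<open>X\<close>, one level \<open>|S| = l\<close> after the other. If there is no
  monochromatic copy, then every interval of dimension \<open>n\<close> meets both colours, so each level can
  be reached in either colour at the cost of \<open>n\<close> new ground elements. This gives \<open>n\<^sup>2 + 2n\<close>. To
  save \<open>3n - 2\<close> elements, one looks at the colours of the sets with at most two elements and of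
  their complements: three of the levels (counted from both ends) can be obtained in the same
  colour with at most two elements in total beyond \<open>X\<close>. For \<open>n = 2\<close> there is too little room for
  this in some cases, and explicit four-element copies are used there.
\<close>

section \<open>Building copies level by level\<close>

definition has_copy :: "nat \<Rightarrow> nat \<Rightarrow> (nat set \<Rightarrow> bool) \<Rightarrow> bool" where
  "has_copy n N P \<longleftrightarrow> (\<exists>S \<subseteq> boolean_lattice N. is_copy (boolean_lattice n) S \<and> (\<forall>x\<in>S. P x))"

text \<open>One colour is a predicate and the other its negation, so that lemmas about
  \<open>P\<close> serve both colours through \<open>copy_free_not\<close>.\<close>

definition copy_free :: "nat \<Rightarrow> nat \<Rightarrow> (nat set \<Rightarrow> bool) \<Rightarrow> bool" where
  "copy_free n N P \<longleftrightarrow> \<not> has_copy n N P \<and> \<not> has_copy n N (\<lambda>S. \<not> P S)"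

text \<open>The levels counted by \<open>l\<close> are 0 to \<open>l - 1\<close>, so a full copy of
  \<open>Q\<^sub>n\<close> needs \<open>l = Suc n\<close>. The set \<open>A\<close> bounds the
  ground elements spent so far; its disjointness from \<open>X\<close> is asked for only when the
  copy is assembled.\<close>

definition partial_copy :: "(nat set \<Rightarrow> bool) \<Rightarrow> nat set \<Rightarrow> nat \<Rightarrow> nat set \<Rightarrow> bool" where
  "partial_copy P X l A \<longleftrightarrow> (\<exists>g.
     (\<forall>S\<subseteq>X. card S < l \<longrightarrow> g S \<subseteq> A \<and> P (S \<union> g S)) \<and>
     (\<forall>S T. S \<subseteq> T \<longrightarrow> T \<subseteq> X \<longrightarrow> card T < l \<longrightarrow> g S \<subseteq> g T))"

lemma copy_free_not: "copy_free n N P \<Longrightarrow> copy_free n N (\<lambda>S. \<not> P S)"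
  by (simp add: copy_free_def)

lemma partial_copy_0: "partial_copy P X 0 A"
  by (simp add: partial_copy_def)

text \<open>The values on the new level contain all of \<open>A\<close>, hence every earlier value.
  Within one level there is nothing to compare, since distinct comparable finite sets differ in
  size.\<close>

lemma partial_copy_Suc:
  assumes "finite X" "partial_copy P X l A" "A \<subseteq> B"
    and "\<And>S. S \<subseteq> X \<Longrightarrow> card S = l \<Longrightarrow> \<exists>Z. A \<subseteq> Z \<and> Z \<subseteq> B \<and> P (S \<union> Z)"
  shows "partial_copy P X (Suc l) B"
proof -
  from assms(2) obtain g where
    g1: "\<And>S. S \<subseteq> X \<Longrightarrow> card S < l \<Longrightarrow> g S \<subseteq> A \<and> P (S \<union> g S)" and
    g2: "\<And>S T. S \<subseteq> T \<Longrightarrow> T \<subseteq> X \<Longrightarrow> card T < l \<Longrightarrow> g S \<subseteq> g T"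
    unfolding partial_copy_def by auto
  from assms(4) obtain h where
    h: "\<And>S. S \<subseteq> X \<Longrightarrow> card S = l \<Longrightarrow> A \<subseteq> h S \<and> h S \<subseteq> B \<and> P (S \<union> h S)"
    by metis
  define g' where "g' S = (if card S = l then h S else g S)" for S
  have "g' S \<subseteq> B \<and> P (S \<union> g' S)" if "S \<subseteq> X" "card S < Suc l" for S
    using g1[of S] h[of S] that assms(3) by (auto simp: g'_def less_Suc_eq)
  moreover have "g' S \<subseteq> g' T" if "S \<subseteq> T" "T \<subseteq> X" "card T < Suc l" for S T
  proof (cases "S = T")
    case False
    then have "card S < card T"
      using that assms(1) by (meson finite_subset psubset_card_mono psubsetI)
    then show ?thesis
      using that g2[of S T] g1[OF order_trans[OF that(1,2)]] h[of T]
      by (cases "card T = l") (auto simp: g'_def)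
  qed simp
  ultimately show ?thesis
    unfolding partial_copy_def by blast
qed

lemma partial_copy_Suc_const:
  assumes "finite X" "partial_copy P X l A" "A \<subseteq> B"
    and "\<And>S. S \<subseteq> X \<Longrightarrow> card S = l \<Longrightarrow> P (S \<union> B)"
  shows "partial_copy P X (Suc l) B"
  using assms by (intro partial_copy_Suc) auto

lemma partial_copy_bottom:
  assumes "finite X" "P A0" "A0 \<subseteq> A" "\<And>x. x \<in> X \<Longrightarrow> P (insert x A)"
  shows "partial_copy P X 2 A"
proof -
  have "partial_copy P X (Suc 0) A0"
    using assms(1,2) by (intro partial_copy_Suc_const[OF _ partial_copy_0[of _ _ A0]])
      (auto dest: finite_subset)
  then have "partial_copy P X (Suc (Suc 0)) A"
    by (rule partial_copy_Suc_const[OF assms(1)]) (use assms in \<open>auto simp: card_Suc_eq\<close>)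
  then show ?thesis
    by (simp add: numeral_2_eq_2)
qed

text \<open>As \<open>A\<close> misses \<open>X\<close>, the set \<open>S\<close> is recovered from
  \<open>S \<union> g S\<close> by intersecting with \<open>X\<close>; hence the map reflects
  inclusion as well as preserving it.\<close>

lemma has_copyI:
  assumes "X \<union> A \<subseteq> {1..N}" "X \<inter> A = {}" "card X = n" "partial_copy P X (Suc n) A"
  shows "has_copy n N P"
proof -
  have fin: "finite X"
    using assms(1) finite_subset by auto
  from assms(4) obtain g where
    g1: "\<And>S. S \<subseteq> X \<Longrightarrow> card S < Suc n \<Longrightarrow> g S \<subseteq> A \<and> P (S \<union> g S)" and
    g2: "\<And>S T. S \<subseteq> T \<Longrightarrow> T \<subseteq> X \<Longrightarrow> card T < Suc n \<Longrightarrow> g S \<subseteq> g T"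
    unfolding partial_copy_def by auto
  have le: "card S < Suc n" if "S \<subseteq> X" for S
    using card_mono[OF fin that] assms(3) by simp
  obtain e where e: "bij_betw e {1..n} X"
    using finite_same_card_bij[of "{1..n}" X] fin assms(3) by auto
  define f where "f S = e ` S \<union> g (e ` S)" for S
  have sub: "e ` S \<subseteq> X" if "S \<subseteq> {1..n}" for S
    using e that by (auto simp: bij_betw_def)
  have val: "g (e ` S) \<subseteq> A" "P (f S)" if "S \<subseteq> {1..n}" for S
    using g1[OF sub[OF that] le[OF sub[OF that]]] by (simp_all add: f_def)
  have trace: "f S \<inter> X = e ` S" if "S \<subseteq> {1..n}" for S
    using val(1)[OF that] sub[OF that] assms(2) unfolding f_def by blast
  have mono: "S \<subseteq> T \<longleftrightarrow> f S \<subseteq> f T" if "S \<subseteq> {1..n}" "T \<subseteq> {1..n}" for S T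
  proof
    assume "S \<subseteq> T"
    then have "e ` S \<subseteq> e ` T" by (rule image_mono)
    moreover from this have "g (e ` S) \<subseteq> g (e ` T)"
      using sub[OF that(2)] le[OF sub[OF that(2)]] by (rule g2)
    ultimately show "f S \<subseteq> f T"
      unfolding f_def by (rule Un_mono)
  next
    assume "f S \<subseteq> f T"
    then have "f S \<inter> X \<subseteq> f T \<inter> X"
      by (rule Int_mono[OF _ order_refl])
    then have "e ` S \<subseteq> e ` T"
      by (simp only: trace[OF that(1)] trace[OF that(2)])
    show "S \<subseteq> T"
    proof
      fix x assume "x \<in> S"
      then have "e x \<in> e ` T"
        using \<open>e ` S \<subseteq> e ` T\<close> by auto
      moreover have "inj_on e {1..n}"
        using e by (rule bij_betw_imp_inj_on)
      ultimately show "x \<in> T"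
        using \<open>x \<in> S\<close> that by (meson inj_on_image_mem_iff subsetD)
    qed
  qed
  have "inj_on f (boolean_lattice n)"
  proof (rule inj_onI)
    fix S T assume "S \<in> boolean_lattice n" "T \<in> boolean_lattice n" "f S = f T"
    then show "S = T"
      using mono[of S T] mono[of T S] by (simp add: boolean_lattice_def order_antisym)
  qed
  then have "is_copy (boolean_lattice n) (f ` boolean_lattice n)"
    unfolding is_copy_def using mono
    by (intro exI[of _ f]) (simp add: bij_betw_def boolean_lattice_def)
  moreover have "f S \<subseteq> {1..N}" if "S \<subseteq> {1..n}" for S
    using val(1)[OF that] sub[OF that] assms(1) unfolding f_def by blast
  then have "f ` boolean_lattice n \<subseteq> boolean_lattice N"
    by (simp add: boolean_lattice_def image_subset_iff)
  moreover have "\<forall>x \<in> f ` boolean_lattice n. P x"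
    using val(2) by (simp add: boolean_lattice_def)
  ultimately show ?thesis
    unfolding has_copy_def by blast
qed

section \<open>Growing a partial copy when no monochromatic copy exists\<close>

text \<open>Otherwise all sets between \<open>W\<close> and \<open>W \<union> D\<close> have the
  opposite colour, and \<open>n\<close> elements of \<open>D\<close> with the constant map to
  \<open>W\<close> give a copy.\<close>

lemma copy_free_interval:
  assumes "copy_free n N P" "W \<union> D \<subseteq> {1..N}" "W \<inter> D = {}" "card D \<ge> n"
  shows "\<exists>Z\<subseteq>D. P (W \<union> Z)"
proof (rule ccontr)
  assume no: "\<not> ?thesis"
  obtain X where X: "X \<subseteq> D" "card X = n" "finite X"
    using obtain_subset_with_card_n[OF assms(4)] by blast
  have "partial_copy (\<lambda>S. \<not> P S) X (Suc n) W"
    unfolding partial_copy_def using no X(1)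
    by (intro exI[of _ "\<lambda>_. W"]) (auto simp: Un_commute)
  then have "has_copy n N (\<lambda>S. \<not> P S)"
    using X assms(2,3) by (intro has_copyI[of X W]) auto
  then show False
    using assms(1) by (simp add: copy_free_def)
qed

text \<open>Each further level is paid for with a block \<open>D\<close> of \<open>n\<close> fresh
  elements: the interval from \<open>S \<union> (B - D)\<close> to \<open>S \<union> B\<close> has
  dimension \<open>n\<close>, so it contains a set of the desired colour.\<close>

lemma partial_copy_extend:
  assumes "copy_free n N P" "X \<union> B \<subseteq> {1..N}" "X \<inter> B = {}"
    and "partial_copy P X l A" "A \<subseteq> B" "card B \<ge> card A + n * k"
  shows "partial_copy P X (l + k) B"
  using assms(2-6)
proof (induction k arbitrary: B)
  case 0
  then have "\<exists>g. (\<forall>S\<subseteq>X. card S < l \<longrightarrow> g S \<subseteq> A \<and> P (S \<union> g S)) \<and>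
     (\<forall>S T. S \<subseteq> T \<longrightarrow> T \<subseteq> X \<longrightarrow> card T < l \<longrightarrow> g S \<subseteq> g T)"
    by (simp add: partial_copy_def)
  then show ?case
    using \<open>A \<subseteq> B\<close> unfolding partial_copy_def by (metis add_0_right order_trans)
next
  case (Suc k)
  have fin: "finite X" "finite B" "finite A"
    using Suc.prems(1,4) by (meson finite_atLeastAtMost finite_subset le_sup_iff)+
  have "n \<le> card (B - A)"
    using Suc.prems(4,5) fin by (simp add: card_Diff_subset)
  then obtain D where D: "D \<subseteq> B - A" "card D = n" "finite D"
    by (rule obtain_subset_with_card_n)
  have "D \<subseteq> B"
    using D by auto
  then have "card (B - D) = card B - n"
    using D by (simp add: card_Diff_subset)
  then have IH: "partial_copy P X (l + k) (B - D)"
    using Suc.prems D by (intro Suc.IH) auto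
  have "\<exists>Z. B - D \<subseteq> Z \<and> Z \<subseteq> B \<and> P (S \<union> Z)" if "S \<subseteq> X" for S
  proof -
    have "\<exists>Z\<subseteq>D. P ((S \<union> (B - D)) \<union> Z)"
      using that Suc.prems(1,2) D by (intro copy_free_interval[OF assms(1)]) auto
    then obtain Z where "Z \<subseteq> D" "P (S \<union> ((B - D) \<union> Z))"
      by (auto simp: Un_assoc)
    then show ?thesis
      using \<open>D \<subseteq> B\<close> by (intro exI[of _ "(B - D) \<union> Z"]) auto
  qed
  then show ?case
    using partial_copy_Suc[OF fin(1) IH, of B] by auto
qed

section \<open>Copies whose highest levels cost nothing\<close>

text \<open>Only the levels 2 to \<open>n - 1\<close> are paid for with \<open>n\<close> elements
  each. The top level consists of \<open>X\<close> alone, and adding \<open>T - X\<close> to it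
  gives exactly \<open>T\<close>.\<close>

lemma two_levels_and_top:
  assumes "copy_free n N P" "n \<ge> 2" "partial_copy P X 2 A" "card X = n" "X \<inter> A = {}"
    and "X \<union> A \<subseteq> T" "T \<subseteq> {1..N}" "P T" "card T \<ge> n + card A + n * (n - 2)"
  shows False
proof -
  have fin: "finite X" "finite T"
    using assms(6,7) by (meson finite_atLeastAtMost finite_subset le_sup_iff)+
  have "card (T - X) = card T - n"
    using assms(4,6) fin by (simp add: card_Diff_subset)
  then have "partial_copy P X (2 + (n - 2)) (T - X)"
    using assms by (intro partial_copy_extend[OF assms(1)]) auto
  then have "partial_copy P X n (T - X)"
    using assms(2) by (simp only: le_add_diff_inverse)
  moreover have "P (S \<union> (T - X))" if "S \<subseteq> X" "card S = n" for S
  proof -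
    have "S = X"
      using that fin assms(4) by (simp add: card_subset_eq)
    then show ?thesis
      using assms(6,8) by (simp add: Un_absorb1)
  qed
  ultimately have "partial_copy P X (Suc n) (T - X)"
    using fin by (intro partial_copy_Suc_const) auto
  then have "has_copy n N P"
    using assms(4,6,7) by (intro has_copyI) auto
  then show False
    using assms(1) by (simp add: copy_free_def)
qed

text \<open>On the last \<open>k\<close> levels take the value \<open>{1..N} - X\<close>. There
  \<open>card S \<ge> n + 1 - k\<close>, so the resulting set has at least \<open>N + 1 - k\<close>
  elements and \<open>top\<close> applies.\<close>

lemma top_levels_free:
  assumes "copy_free n N P" "partial_copy P X l A" "card X = n" "X \<inter> A = {}"
    and "X \<union> A \<subseteq> {1..N}" "N \<ge> n + card A + n * j" "l + j + k = Suc n"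
    and top: "\<And>U. {1..N} - X \<subseteq> U \<Longrightarrow> U \<subseteq> {1..N} \<Longrightarrow> card U + k > N \<Longrightarrow> P U"
  shows False
proof -
  let ?V = "{1..N}"
  have X: "finite X" "X \<subseteq> ?V"
    using assms(5) finite_subset by auto
  have card_B: "card (?V - X) = N - n"
    using X assms(3) by (simp add: card_Diff_subset)
  have "n \<le> N"
    using assms(6) by simp
  have "partial_copy P X (l + j + i) (?V - X)" if "i \<le> k" for i
    using that
  proof (induction i)
    case 0
    have "partial_copy P X (l + j) (?V - X)"
      using assms card_B by (intro partial_copy_extend[OF assms(1)]) auto
    then show ?case by simp
  next
    case (Suc i)
    then have "partial_copy P X (Suc (l + j + i)) (?V - X)"
    proof (intro partial_copy_Suc_const[OF X(1), of P "l + j + i" "?V - X"])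
      fix S assume S: "S \<subseteq> X" "card S = l + j + i"
      then have "card (S \<union> (?V - X)) = l + j + i + (N - n)"
        using X card_B by (subst card_Un_disjoint) (auto dest: finite_subset)
      then show "P (S \<union> (?V - X))"
        using S X \<open>n \<le> N\<close> assms(7) Suc.prems by (intro top) auto
    qed auto
    then show ?case by simp
  qed
  from this[of k] have "partial_copy P X (Suc n) (?V - X)"
    using assms(7) by simp
  then have "has_copy n N P"
    using X assms(3) by (intro has_copyI) auto
  then show False
    using assms(1) by (simp add: copy_free_def)
qed

section \<open>Four-element copies for dimension two\<close>

lemma has_copy_diamond:
  assumes "P A" "P B" "P C" "P D" "A \<subseteq> B" "A \<subseteq> C" "B \<subseteq> D" "C \<subseteq> D"
    "\<not> B \<subseteq> C" "\<not> C \<subseteq> B" "D \<subseteq> {1..N}"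
  shows "has_copy 2 N P"
proof -
  have Q2: "boolean_lattice 2 = {{}, {1}, {2}, {1, 2}}"
  proof -
    have "{1..2} = {1, 2::nat}" by auto
    then show ?thesis
      unfolding boolean_lattice_def by (auto simp: Pow_insert)
  qed
  define f where "f S = (if S = {} then A else if S = {1} then B else if S = {2} then C else D)"
    for S :: "nat set"
  have f: "f {} = A" "f {1} = B" "f {2} = C" "f {1, 2} = D"
    by (auto simp: f_def doubleton_eq_iff)
  have ord: "\<forall>x\<in>boolean_lattice 2. \<forall>y\<in>boolean_lattice 2. x \<subseteq> y \<longleftrightarrow> f x \<subseteq> f y"
    unfolding Q2 using assms(5-10) f by auto
  have "inj_on f (boolean_lattice 2)"
  proof (rule inj_onI)
    fix x y assume "x \<in> boolean_lattice 2" "y \<in> boolean_lattice 2" "f x = f y"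
    then have "x \<subseteq> y" "y \<subseteq> x"
      using ord by simp_all
    then show "x = y" by blast
  qed
  then have "is_copy (boolean_lattice 2) (f ` boolean_lattice 2)"
    unfolding is_copy_def using ord by (intro exI[of _ f]) (simp add: bij_betw_def)
  moreover have "f ` boolean_lattice 2 = {A, B, C, D}"
    unfolding Q2 using f by simp
  moreover have "{A, B, C, D} \<subseteq> boolean_lattice N"
    using assms(5-8,11) unfolding boolean_lattice_def by blast
  moreover have "\<forall>x\<in>{A, B, C, D}. P x"
    using assms(1-4) by simp
  ultimately show ?thesis
    unfolding has_copy_def by metis
qed

lemma copy_free_diamond:
  assumes "copy_free 2 N P" "A \<subseteq> B" "A \<subseteq> C" "B \<subseteq> D" "C \<subseteq> D"
    "\<not> B \<subseteq> C" "\<not> C \<subseteq> B" "D \<subseteq> {1..N}"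
  shows "\<not> (P A \<and> P B \<and> P C \<and> P D)" and "P A \<or> P B \<or> P C \<or> P D"
  using has_copy_diamond[of P A B C D N] has_copy_diamond[of "\<lambda>S. \<not> P S" A B C D N] assms
  unfolding copy_free_def by metis+

section \<open>Colours of sets missing at most one element\<close>

lemma square_minus_self:
  fixes n :: nat
  assumes "n \<ge> 2"
  shows "n^2 - n = n + n * (n - 2)"
proof -
  obtain m where "n = 2 + m"
    using le_Suc_ex[OF assms] by auto
  then show ?thesis
    by (simp add: power2_eq_square)
qed

text \<open>Red is the colour opposite to that of the empty set. If \<open>n\<close> singletons
  inside \<open>T\<close> had the colour \<open>P\<close>, they would form level 1 between
  \<open>{}\<close> and \<open>T\<close> of a copy; likewise \<open>n\<close> pairs through
  \<open>y\<close>, at the cost of the one element \<open>y\<close>. So fewer than \<open>n\<close>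
  of each have colour \<open>P\<close>.\<close>

lemma red_point:
  fixes n :: nat
  assumes "copy_free n (n^2 - n + 2) P" "n \<ge> 2" "P {}"
    and T: "T \<subseteq> {1..n^2 - n + 2}" "P T" "card T \<ge> n^2 - n + 1"
  obtains y where "y \<in> T" "\<not> P {y}" "card {x \<in> T - {y}. \<not> P {y, x}} \<ge> card T - n"
proof -
  have fin: "finite T"
    using T(1) finite_subset by auto
  note sq = square_minus_self[OF assms(2)]
  have low: "card {x \<in> T. P {x}} < n"
  proof (rule ccontr)
    assume "\<not> ?thesis"
    then have "n \<le> card {x \<in> T. P {x}}"
      by simp
    then obtain X where X: "X \<subseteq> {x \<in> T. P {x}}" "card X = n" "finite X"
      by (rule obtain_subset_with_card_n)
    have "partial_copy P X 2 {}"
      by (rule partial_copy_bottom[of X P "{}" "{}", OF X(3) assms(3)]) (use X(1) in auto)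
    moreover have "X \<subseteq> T"
      using X(1) by auto
    ultimately show False
      using X(2) T sq by (intro two_levels_and_top[OF assms(1,2), of X "{}" T]) simp_all
  qed
  moreover have "n \<le> card T"
    using T(3) sq by simp
  ultimately have "{x \<in> T. P {x}} \<noteq> T"
    by auto
  then obtain y where y: "y \<in> T" "\<not> P {y}"
    by auto
  have "card {x \<in> T - {y}. P {y, x}} < n"
  proof (rule ccontr)
    assume "\<not> ?thesis"
    then have "n \<le> card {x \<in> T - {y}. P {y, x}}"
      by simp
    then obtain X where X: "X \<subseteq> {x \<in> T - {y}. P {y, x}}" "card X = n" "finite X"
      by (rule obtain_subset_with_card_n)
    have "partial_copy P X 2 {y}"
      by (rule partial_copy_bottom[of X P "{}" "{y}", OF X(3) assms(3)])
        (use X(1) in \<open>auto simp: insert_commute\<close>)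
    moreover have "X \<subseteq> T" "X \<inter> {y} = {}"
      using X(1) by auto
    ultimately show False
      using X(2) T y(1) sq by (intro two_levels_and_top[OF assms(1,2), of X "{y}" T]) simp_all
  qed
  moreover have "card (T - {y}) = card {x \<in> T - {y}. P {y, x}} + card {x \<in> T - {y}. \<not> P {y, x}}"
    using fin by (subst card_Un_disjoint[symmetric]) (auto intro!: arg_cong[of _ _ card])
  ultimately have "card {x \<in> T - {y}. \<not> P {y, x}} \<ge> card T - n"
    using y fin by simp
  with y that show thesis by blast
qed

text \<open>Suppose such a \<open>T\<close> had colour \<open>P\<close>. The red point and red pairs
  from \<open>red_point\<close> rule out red tops, first the full set and then all coatoms but one.
  So many sets of colour \<open>P\<close> at the top, together with \<open>{}\<close>, yield a
  copy.\<close>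

lemma large_same_colour_as_empty:
  fixes n :: nat
  assumes cf: "copy_free n (n^2 - n + 2) P" and n: "n \<ge> 2" and "P {}"
    and T: "T \<subseteq> {1..n^2 - n + 2}" "card T \<ge> n^2 - n + 1"
  shows "\<not> P T"
proof
  assume "P T"
  define V where "V = {1..n^2 - n + 2}"
  have V: "finite V" "card V = n^2 - n + 2"
    by (simp_all add: V_def)
  note sq = square_minus_self[OF n]
  have V2: "card V = 4" if "n = 2"
    using V that by simp
  \<comment> \<open>A red copy with \<open>{y}\<close> at level 0, the red pairs at level 1 and
    \<open>U\<close> on top.\<close>
  have red: False if "X \<subseteq> {x \<in> V - {y}. \<not> P {y, x}}" "card X = n" "X \<subseteq> U" "y \<in> U"
    "\<not> P {y}" "\<not> P U" "U \<subseteq> V" "card U \<ge> n^2 - n + 1" for X U y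
  proof -
    have "finite X"
      using that(7) V(1) that(3) by (meson finite_subset)
    then have "partial_copy (\<lambda>S. \<not> P S) X 2 {y}"
      by (rule partial_copy_bottom[of _ _ "{y}"]) (use that(1,5) in \<open>auto simp: insert_commute\<close>)
    moreover have "X \<inter> {y} = {}"
      using that(1) by auto
    ultimately show False
      using that(2-) sq unfolding V_def
      by (intro two_levels_and_top[OF copy_free_not[OF cf] n, of X "{y}" U]) simp_all
  qed
  have "P V"
  proof (rule ccontr)
    assume "\<not> P V"
    obtain y where y: "y \<in> T" "\<not> P {y}" "card {x \<in> T - {y}. \<not> P {y, x}} \<ge> card T - n"
      using red_point[OF cf n assms(3) T(1) \<open>P T\<close> T(2)] .
    let ?R = "{x \<in> T - {y}. \<not> P {y, x}}"
    have yV: "y \<in> V"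
      using y T by (auto simp: V_def)
    \<comment> \<open>Two red pairs are needed for \<open>red\<close>. The count guarantees
      \<open>n\<close> of them for \<open>n \<ge> 3\<close>, but only one for
      \<open>n = 2\<close>.\<close>
    show False
    proof (cases "n = 2")
      case True
      then have "card ?R \<noteq> 0"
        using y(3) T(2) by simp
      then obtain q where q: "q \<in> T" "q \<noteq> y" "\<not> P {y, q}"
        by (metis (no_types, lifting) DiffE Collect_empty_eq card.empty singletonI)
      have "q \<in> V"
        using q T by (auto simp: V_def)
      then have "card (V - {y, q}) = 2"
        using V V2 True q yV by (subst card_Diff_subset) auto
      then obtain p z where pz: "V - {y, q} = {p, z}" "p \<noteq> z"
        by (auto simp: card_2_iff)
      have d: "p \<noteq> y" "p \<noteq> q" "z \<noteq> y" "z \<noteq> q" "p \<in> V" "z \<in> V"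
        using pz by blast+
      have cf2: "copy_free 2 (n^2 - n + 2) P"
        using cf True by simp
      note D = copy_free_diamond[OF cf2, folded V_def]
      \<comment> \<open>Since \<open>{y}\<close>, \<open>{y, q}\<close> and \<open>V\<close> are
        red, every set containing \<open>y\<close> and incomparable to \<open>{y, q}\<close> has
        colour \<open>P\<close>. Three such sets form a diamond with \<open>{}\<close>.\<close>
      have "P {y, p}" "P {y, z}" "P {y, p, z}"
        using D(2)[of "{y}" "{y, q}" "{y, p}" V] D(2)[of "{y}" "{y, q}" "{y, z}" V]
          D(2)[of "{y}" "{y, q}" "{y, p, z}" V] y q d pz yV \<open>q \<in> V\<close> \<open>\<not> P V\<close> by auto
      then show False
        using D(1)[of "{}" "{y, p}" "{y, z}" "{y, p, z}"] assms(3) d pz yV by auto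
    next
      case False
      then have "n \<le> n * (n - 2)"
        using n by simp
      then have "n \<le> card ?R"
        using y(3) T(2) sq by linarith
      then obtain X where X: "X \<subseteq> ?R" "card X = n" "finite X"
        by (rule obtain_subset_with_card_n)
      then have "X \<subseteq> V"
        using T(1) by (auto simp: V_def)
      then show False
        using red[of X y V] X y yV T(1) V \<open>\<not> P V\<close> by auto
    qed
  qed
  obtain y where y: "y \<in> V" "\<not> P {y}" "card {x \<in> V - {y}. \<not> P {y, x}} \<ge> card V - n"
    using red_point[OF cf n assms(3), folded V_def, of V] \<open>P V\<close> V by auto
  let ?R = "{x \<in> V - {y}. \<not> P {y, x}}"
  have coatoms: "P (V - {z})" if z: "z \<in> V" "z \<noteq> y" for z
  proof (rule ccontr)
    assume "\<not> P (V - {z})"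
    show False
    proof (cases "n = 2")
      case True
      have cf2: "copy_free 2 (n^2 - n + 2) P"
        using cf True by simp
      note D = copy_free_diamond[OF cf2, folded V_def]
      have "2 \<le> card ?R"
        using y(3) V2 True by simp
      then obtain Y where "Y \<subseteq> ?R" "card Y = 2" "finite Y"
        by (rule obtain_subset_with_card_n)
      then obtain p q where pq: "p \<in> ?R" "q \<in> ?R" "p \<noteq> q"
        by (auto simp: card_2_iff)
      have "card (V - {y, p, q}) = 1"
        using V V2 True pq y by (subst card_Diff_subset) auto
      then obtain w where w: "V - {y, p, q} = {w}"
        by (auto simp: card_1_singleton_iff)
      have d: "w \<noteq> y" "w \<noteq> p" "w \<noteq> q" "w \<in> V"
        using w by blast+
      have Veq: "V = {y, p, q, w}"
        using w pq y by blast
      \<comment> \<open>The three coatoms containing \<open>y\<close> are forced in turn: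
        \<open>{y, p, q}\<close> by the red \<open>{y}\<close>, \<open>{y, p}\<close>,
        \<open>{y, q}\<close>, which makes \<open>{y, w}\<close> red, and then the other two by
        diamonds from \<open>{y}\<close>.\<close>
      have "P {y, p, q}"
        using D(2)[of "{y}" "{y, p}" "{y, q}" "{y, p, q}"] y pq by auto
      then have "\<not> P {y, w}"
        using D(1)[of "{}" "{y, w}" "{y, p, q}" V] \<open>P V\<close> assms(3) y pq d by auto
      then have "P {y, p, w}" "P {y, q, w}"
        using D(2)[of "{y}" "{y, p}" "{y, w}" "{y, p, w}"]
          D(2)[of "{y}" "{y, q}" "{y, w}" "{y, q, w}"] y pq d by auto
      moreover have "V - {z} = {y, p, q} \<or> V - {z} = {y, p, w} \<or> V - {z} = {y, q, w}"
        using z Veq d pq by auto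
      ultimately show False
        using \<open>P {y, p, q}\<close> \<open>\<not> P (V - {z})\<close> by metis
    next
      case False
      then have "n \<le> n * (n - 2)"
        using n by simp
      \<comment> \<open>One pair more than \<open>n\<close> is wanted, as \<open>X\<close> must also
        avoid \<open>z\<close> to lie inside \<open>V - {z}\<close>.\<close>
      then have "n + 1 \<le> card ?R"
        using y(3) V(2) sq by linarith
      moreover have "card ?R - 1 \<le> card (?R - {z})"
        by (simp add: card_Diff_singleton_if)
      ultimately have "n \<le> card (?R - {z})"
        by linarith
      then obtain X where X: "X \<subseteq> ?R - {z}" "card X = n" "finite X"
        by (rule obtain_subset_with_card_n)
      then show False
        using red[of X y "V - {z}"] z y V \<open>\<not> P (V - {z})\<close> by auto
    qed
  qed
  \<comment> \<open>The colour of \<open>V - {y}\<close> is not known. With \<open>y\<close> outside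
    \<open>X\<close>, the two highest levels use only \<open>V\<close> and coatoms
    \<open>V - {z}\<close> with \<open>z \<noteq> y\<close>.\<close>
  have "n \<le> card (V - {y})"
    using V y sq by simp
  then obtain X where X: "X \<subseteq> V - {y}" "card X = n" "finite X"
    by (rule obtain_subset_with_card_n)
  have "partial_copy P X (Suc 0) {}"
    using X assms(3) by (intro partial_copy_Suc_const[OF _ partial_copy_0[of _ _ "{}"]])
      (auto dest: finite_subset)
  moreover have "P U" if U: "V - X \<subseteq> U" "U \<subseteq> V" "card U + 2 > card V" for U
  proof -
    have "card (V - U) \<le> 1"
      using U V finite_subset[OF U(2)] by (subst card_Diff_subset) auto
    then consider "V - U = {}" | z where "V - U = {z}"
      using V by (metis card_1_singletonE card_0_eq finite_Diff le_antisym less_one not_less)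
    then show ?thesis
    proof cases
      case 1
      then show ?thesis
        using U \<open>P V\<close> by (metis Diff_eq_empty_iff order_antisym)
    next
      case 2
      then have "U = V - {z}" "z \<in> V" "z \<noteq> y"
        using U X y by blast+
      then show ?thesis
        using coatoms by simp
    qed
  qed
  moreover have "X \<subseteq> V" "card V = n + n * (n - 2) + 2"
    using X(1) V(2) sq by auto
  ultimately show False
    using X(2) n V_def V(2)
    by (intro top_levels_free[OF cf, of X "Suc 0" "{}" "n - 2" 2]) simp_all
qed

section \<open>The contradiction for dimension at least two\<close>

lemma not_copy_free:
  fixes n :: nat
  assumes n: "n \<ge> 2" and "P {}"
  shows "\<not> copy_free n (n^2 - n + 2) P"
proof
  assume cf: "copy_free n (n^2 - n + 2) P"
  define N where "N = n^2 - n + 2"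
  note cf' = copy_free_not[OF cf, folded N_def]
  have N: "N = n + n * (n - 2) + 2"
    unfolding N_def using square_minus_self[OF n] by simp
  have top: "\<not> P U" if "U \<subseteq> {1..N}" "card U > N - 2" for U
    using large_same_colour_as_empty[OF cf n assms(2), of U] that by (auto simp: N_def)
  \<comment> \<open>A red \<open>{y}\<close> would serve as level 0 of a red copy at the cost of one
    element, with the two highest levels free by \<open>top\<close>.\<close>
  have atoms: "P {y}" if y: "y \<in> {1..N}" for y
  proof (rule ccontr)
    assume "\<not> P {y}"
    have "n \<le> card ({1..N} - {y})"
      using y N by simp
    then obtain X where X: "X \<subseteq> {1..N} - {y}" "card X = n" "finite X"
      by (rule obtain_subset_with_card_n)
    have "partial_copy (\<lambda>S. \<not> P S) X (Suc 0) {y}"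
      using X \<open>\<not> P {y}\<close> by (intro partial_copy_Suc_const[OF _ partial_copy_0[of _ _ "{y}"]])
        (auto dest: finite_subset)
    then show False
      using X y N n top by (intro top_levels_free[OF cf', of X "Suc 0" "{y}" "n - 2" 2]) auto
  qed
  show False
  proof (cases "\<exists>T\<subseteq>{1..N}. P T \<and> card T \<ge> N - 2")
    \<comment> \<open>Levels 0 and 1 are \<open>{}\<close> and singletons, so nothing is spent
      beyond \<open>X\<close> there, and \<open>N - 2 = n + n * (n - 2)\<close> elements in
      \<open>T\<close> suffice.\<close>
    case True
    then obtain T where T: "T \<subseteq> {1..N}" "P T" "card T \<ge> N - 2"
      by auto
    have "n \<le> card T"
      using T(3) N by simp
    then obtain X where X: "X \<subseteq> T" "card X = n" "finite X"
      by (rule obtain_subset_with_card_n)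
    have "partial_copy P X 2 {}"
      using X T atoms assms(2) by (intro partial_copy_bottom[of _ _ "{}"]) auto
    then show False
      using X T N by (intro two_levels_and_top[OF cf[folded N_def] n, of X "{}" T]) auto
  next
    \<comment> \<open>Now all sets with at least \<open>N - 2\<close> elements are red: three levels
      are free at the top, and the lower \<open>n - 2\<close> levels are paid for in full.\<close>
    case False
    obtain X where X: "X \<subseteq> {1..N}" "card X = n"
      using obtain_subset_with_card_n[of n "{1..N}"] N by auto
    have "\<not> P U" if "U \<subseteq> {1..N}" "card U + 3 > N" for U
    proof -
      have "card U \<ge> N - 2"
        using that(2) by linarith
      then show ?thesis
        using False that(1) by blast
    qed
    then show False
      using X N n
      by (intro top_levels_free[OF cf' partial_copy_0, of X "{}" "n - 2" 3]) simp_all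
  qed
qed

section \<open>Dimension one and the final bound\<close>

text \<open>Pigeonhole on the chain \<open>{}\<close>, \<open>{1}\<close>, \<open>{1, 2}\<close>:
  two of its members share a colour, and they form a copy of \<open>Q\<^sub>1\<close>.\<close>

lemma not_copy_free_1: "\<not> copy_free 1 2 P"
proof
  assume cf: "copy_free 1 2 P"
  have chain: "has_copy 1 2 Q" if "Q A0" "A0 \<subseteq> A" "Q (insert x A)" "insert x A \<subseteq> {1..2}" "x \<notin> A"
    for Q A0 A x
    using that partial_copy_bottom[of "{x}" Q A0 A]
    by (intro has_copyI[of "{x}" A]) (auto simp: numeral_2_eq_2)
  have "\<not> (Q {} \<and> Q {1})" "\<not> (Q {} \<and> Q {1, 2})" "\<not> (Q {1} \<and> Q {1, 2})"
    if "\<not> has_copy 1 2 Q" for Q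
    using that chain[of Q "{}" "{}" 1] chain[of Q "{}" "{1}" 2] chain[of Q "{1}" "{1}" 2]
    by (simp_all add: insert_commute[of 2 1] del: One_nat_def) blast+
  from this[of P] this[of "\<lambda>S. \<not> P S"] show False
    using cf by (auto simp: copy_free_def)
qed

theorem theorem5:
  fixes n :: nat
  assumes "n \<ge> 1"
  shows "poset_ramsey (boolean_lattice n) (boolean_lattice n) \<le> enat (n^2 - n + 2)"
proof -
  have "has_copy n (n^2 - n + 2) (\<lambda>S. c S = Red) \<or> has_copy n (n^2 - n + 2) (\<lambda>S. c S = Blue)"
    for c :: "nat set \<Rightarrow> colour"
  proof -
    \<comment> \<open>Taking \<open>P\<close> as the colour of the empty set makes the assumption
      \<open>P {}\<close> hold for every colouring.\<close>
    have "\<not> copy_free n (n^2 - n + 2) (\<lambda>S. c S = c {})"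
    proof (cases "n = 1")
      case True
      then have "n^2 - n + 2 = 2"
        by simp
      then show ?thesis
        using not_copy_free_1 True by metis
    next
      case False
      then show ?thesis
        using not_copy_free[of n "\<lambda>S. c S = c {}"] assms by auto
    qed
    moreover have "x \<noteq> Red \<longleftrightarrow> x = Blue" "x \<noteq> Blue \<longleftrightarrow> x = Red" for x
      by (cases x; simp)+
    ultimately show ?thesis
      unfolding copy_free_def by (cases "c {}") (simp_all, blast)
  qed
  then have "ramsey_property (n^2 - n + 2) (boolean_lattice n) (boolean_lattice n)"
    unfolding ramsey_property_def has_copy_def by blast
  then show ?thesis
    unfolding poset_ramsey_def by (auto intro: Inf_lower)
qed

end
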